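(* Let $\{\boldsymbol{\xi}_1, \dots, \boldsymbol{\xi}_N\}$ be a type-1 symmetric cubature rule of degree $K$ with positive weights. Assume there are no cubature nodes shared between orthants (i.e., on the plane of symmetry). Then there exist $I = 2^d \binom{\lfloor \frac{K-1}{2} \rfloor + d}{d}$ indices $i_1, i_2, \dots, i_I$ such that $\{\boldsymbol{\xi}_{i_1}, \boldsymbol{\xi}_{i_2}, \dots, \boldsymbol{\xi}_{i_I}\}$ forms a type-1 symmetric cubature rule of degree $K-1$ with positive weights.
   Context: Let $P$ be a probability measure on $\Xi \subset \mathbb{R}^d$, and let $\mathbb{P}(D,d)$ be the set of all $d$-variate polynomials of degree equal to or less than $D$. An $n$-node cubature rule consists of nodes $\boldsymbol{\xi}_1,\dots,\boldsymbol{\xi}_n \in \mathbb{R}^d$ and real weights $w_1,\dots,w_n$, and approximates $\int_\Xi u(\boldsymbol{\xi})\,dP(\boldsymbol{\xi})$ by $\sum_{k=1}^n u(\boldsymbol{\xi}_k) w_k$. A set of nodes is said to form a cubature rule with certain properties if there are weights on these nodes such that the resulting rule has those properties. The degree of a cubature rule is the number $D$ such that all polynomials $p \in \mathbb{P}(D,d)$ are integrated exactly and at least one polynomial $p \in \mathbb{P}(D+1,d)$ exists that is not integrated exactly. A cubature rule has positive weights if all its weights are positive. A cubature rule is type-1 symmetric if, for every coordinate $x^{(k)}$, $k=1,\dots,d$, its nodes and weights are symmetric under reflection in the plane $x^{(k)} = 0$ (nodes are mapped to nodes, and mirror-image nodes have equal weights). These planes of symmetry divide the space into $2^d$ orthants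 (multi-dimensional quadrants); a node is shared between orthants if it lies on one of the planes of symmetry.
   Formalization: The resulting rule is claimed to have degree at least K-1 (exact on all polynomials of degree up to K-1), since degree exactly K-1 is impossible for odd K, and the I indices may repeat, so it has at most I nodes; K ≥ 1 is assumed. *)

theory Defs
  imports "HOL-Probability.Probability"
begin

text \<open>Polynomials are the functions they induce on the whole space, because the nodes of a
  rule need not lie in the support of the measure. The degree is the total degree.\<close>

definition monomial_fun :: "('n::finite \<Rightarrow> nat) \<Rightarrow> real ^ 'n \<Rightarrow> real" where
  "monomial_fun \<alpha> x = (\<Prod>k\<in>UNIV. (x $ k) ^ \<alpha> k)"

definition exponents_le :: "nat \<Rightarrow> ('n::finite \<Rightarrow> nat) set" where
  "exponents_le D = {\<alpha>. (\<Sum>k\<in>UNIV. \<alpha> k) \<le> D}"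

lemma finite_exponents_le: "finite (exponents_le D :: ('n::finite \<Rightarrow> nat) set)"
proof (rule finite_subset)
  show "exponents_le D \<subseteq> (Pi\<^sub>E UNIV (\<lambda>_. {..D}) :: ('n \<Rightarrow> nat) set)"
  proof
    fix \<alpha> :: "'n \<Rightarrow> nat"
    assume "\<alpha> \<in> exponents_le D"
    then have "\<alpha> k \<le> D" for k
      using member_le_sum[of k UNIV \<alpha>] by (simp add: exponents_le_def)
    then show "\<alpha> \<in> Pi\<^sub>E UNIV (\<lambda>_. {..D})"
      by auto
  qed
  show "finite (Pi\<^sub>E UNIV (\<lambda>_. {..D}) :: ('n \<Rightarrow> nat) set)"
    by (rule finite_PiE) auto
qed

definition polys_le :: "nat \<Rightarrow> (real ^ 'n::finite \<Rightarrow> real) set" where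
  "polys_le D = {p. \<exists>c. p = (\<lambda>x. \<Sum>\<alpha>\<in>exponents_le D. c \<alpha> * monomial_fun \<alpha> x)}"

text \<open>A cubature rule is a finite set \<open>X\<close> of nodes together with a weight function \<open>w\<close>, of which
  only the values on \<open>X\<close> matter. Exactness includes integrability: the Bochner integral of a
  function that is not integrable is \<open>0\<close> by convention.\<close>

definition integrates_exactly ::
    "(real ^ 'n::finite) measure \<Rightarrow> (real ^ 'n) set \<Rightarrow> (real ^ 'n \<Rightarrow> real) \<Rightarrow> (real ^ 'n \<Rightarrow> real) \<Rightarrow> bool" where
  "integrates_exactly P X w u \<longleftrightarrow> integrable P u \<and> (\<integral>x. u x \<partial>P) = (\<Sum>x\<in>X. u x * w x)"

definition cubature_degree_ge ::
    "(real ^ 'n::finite) measure \<Rightarrow> (real ^ 'n) set \<Rightarrow> (real ^ 'n \<Rightarrow> real) \<Rightarrow> nat \<Rightarrow> bool" where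
  "cubature_degree_ge P X w D \<longleftrightarrow> (\<forall>p\<in>polys_le D. integrates_exactly P X w p)"

definition cubature_degree ::
    "(real ^ 'n::finite) measure \<Rightarrow> (real ^ 'n) set \<Rightarrow> (real ^ 'n \<Rightarrow> real) \<Rightarrow> nat \<Rightarrow> bool" where
  "cubature_degree P X w D \<longleftrightarrow>
     cubature_degree_ge P X w D \<and> (\<exists>p\<in>polys_le (D + 1). \<not> integrates_exactly P X w p)"

definition positive_weights :: "(real ^ 'n::finite) set \<Rightarrow> (real ^ 'n \<Rightarrow> real) \<Rightarrow> bool" where
  "positive_weights X w \<longleftrightarrow> (\<forall>x\<in>X. 0 < w x)"

definition reflect_coord :: "'n::finite \<Rightarrow> real ^ 'n \<Rightarrow> real ^ 'n" where
  "reflect_coord k x = (\<chi> j. if j = k then - (x $ j) else x $ j)"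

definition type1_symmetric :: "(real ^ 'n::finite) set \<Rightarrow> (real ^ 'n \<Rightarrow> real) \<Rightarrow> bool" where
  "type1_symmetric X w \<longleftrightarrow>
     (\<forall>k. \<forall>x\<in>X. reflect_coord k x \<in> X \<and> w (reflect_coord k x) = w x)"

definition shared_between_orthants :: "real ^ 'n::finite \<Rightarrow> bool" where
  "shared_between_orthants x \<longleftrightarrow> (\<exists>k. x $ k = 0)"

end

theory Submission
  imports Defs
begin

text \<open>The monomials split into two kinds. One with an odd exponent changes sign under some
  coordinate reflection, so every type-1 symmetric rule sums it to zero. One with only even
  exponents depends on a node \<open>x\<close> only through the vector of absolute values \<open>\<bar>x\<bar>\<close>, and up to
  degree \<open>K - 1\<close> it has the form \<open>x\<^sup>2\<^sup>\<beta>\<close> with \<open>\<beta>\<close> of degree at most \<open>(K - 1) div 2\<close>. There are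
  only \<open>M = ((K - 1) div 2 + d) choose d\<close> such \<open>\<beta>\<close>.

  So the nodes with the same \<open>\<bar>x\<bar>\<close> are merged into one point that carries their total weight. The
  sums of the even monomials over the merged points are \<open>M\<close> linear conditions, and Caratheodory's
  argument for cones (\<open>caratheodory_positive_weights\<close>) finds at most \<open>M\<close> of these points with
  new positive weights that satisfy the same conditions. Spreading each new weight evenly over the
  nodes that were merged makes the rule symmetric again; since at most \<open>2 ^ d\<close> nodes have the same
  \<open>\<bar>x\<bar>\<close>, at most \<open>2 ^ d * M\<close> nodes are left. On each monomial of degree at most \<open>K - 1\<close> the new
  rule has the same sum as the old one, which is exact there.\<close>


section \<open>Caratheodory's argument for positive weights\<close>

text \<open>A homogeneous linear system with more unknowns than equations has a nontrivial solution.
  The induction on the set of equations is Gaussian elimination: one equation is solved for one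
  unknown, which is then substituted in the others.\<close>

lemma underdetermined_system_nontrivial_solution:
  fixes f :: "'j \<Rightarrow> 'a \<Rightarrow> real"
  assumes "finite J" "finite A" "card J < card A"
  shows "\<exists>c. (\<exists>x\<in>A. c x \<noteq> 0) \<and> (\<forall>j\<in>J. (\<Sum>x\<in>A. c x * f j x) = 0)"
  using assms
proof (induction J arbitrary: f A rule: finite_induct)
  case empty
  then obtain x where "x \<in> A"
    by fastforce
  then show ?case
    by (intro exI[of _ "\<lambda>_. 1"]) auto
next
  case (insert b J)
  show ?case
  proof (cases "\<forall>x\<in>A. f b x = 0")
    case True
    have "card J < card A"
      using insert by simp
    then obtain c where "\<exists>x\<in>A. c x \<noteq> 0" "\<forall>j\<in>J. (\<Sum>x\<in>A. c x * f j x) = 0"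
      using insert.IH[OF insert.prems(1)] by blast
    with True show ?thesis
      by (intro exI[of _ c]) auto
  next
    case False
    then obtain p where p: "p \<in> A" "f b p \<noteq> 0"
      by blast
    define g where "g j x = f j x - f j p * f b x / f b p" for j x
    have "card J < card (A - {p})"
      using insert p by simp
    then obtain c where c: "\<exists>x\<in>A - {p}. c x \<noteq> 0" "\<forall>j\<in>J. (\<Sum>x\<in>A - {p}. c x * g j x) = 0"
      using insert.IH[of "A - {p}" g] insert.prems(1) by blast
    define s where "s = (\<Sum>x\<in>A - {p}. c x * f b x)"
    define c' where "c' = c(p := - s / f b p)"
    have split: "(\<Sum>x\<in>A. c' x * h x) = - s / f b p * h p + (\<Sum>x\<in>A - {p}. c x * h x)" for h
    proof -
      have "(\<Sum>x\<in>A. c' x * h x) = c' p * h p + (\<Sum>x\<in>A - {p}. c' x * h x)"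
        using insert.prems(1) p(1) by (rule sum.remove)
      also have "(\<Sum>x\<in>A - {p}. c' x * h x) = (\<Sum>x\<in>A - {p}. c x * h x)"
        by (rule sum.cong) (auto simp: c'_def)
      finally show ?thesis
        by (simp add: c'_def)
    qed
    have "(\<Sum>x\<in>A. c' x * f j x) = 0" if "j \<in> J" for j
    proof -
      have "0 = (\<Sum>x\<in>A - {p}. c x * g j x)"
        using c(2) that by simp
      also have "\<dots> = (\<Sum>x\<in>A - {p}. c x * f j x - f j p / f b p * (c x * f b x))"
        by (rule sum.cong) (auto simp: g_def field_simps)
      also have "\<dots> = (\<Sum>x\<in>A - {p}. c x * f j x) - f j p / f b p * s"
        by (simp add: sum_subtractf sum_distrib_left s_def)
      finally show ?thesis
        by (simp add: split)
    qed
    moreover have "(\<Sum>x\<in>A. c' x * f b x) = 0"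
      using p(2) by (simp add: split s_def)
    moreover have "\<exists>x\<in>A. c' x \<noteq> 0"
      using c(1) by (auto simp: c'_def)
    ultimately show ?thesis
      by (intro exI[of _ c']) auto
  qed
qed

text \<open>As long as there are more points than conditions, the weights can be moved along a direction
  \<open>c\<close> that does not change the conditions, until the first weight becomes zero.\<close>

lemma caratheodory_positive_weights:
  fixes f :: "'j \<Rightarrow> 'a \<Rightarrow> real" and w :: "'a \<Rightarrow> real"
  assumes "finite J" "finite A" "\<forall>x\<in>A. 0 < w x"
  shows "\<exists>B v. B \<subseteq> A \<and> card B \<le> card J \<and> (\<forall>x\<in>B. 0 < v x) \<and>
    (\<forall>j\<in>J. (\<Sum>x\<in>B. v x * f j x) = (\<Sum>x\<in>A. w x * f j x))"
  using assms(2,3)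
proof (induction "card A" arbitrary: A w rule: less_induct)
  case less
  show ?case
  proof (cases "card A \<le> card J")
    case True
    with less.prems show ?thesis
      by (intro exI[of _ A] exI[of _ w]) auto
  next
    case False
    then obtain c0 where c0: "\<exists>x\<in>A. c0 x \<noteq> 0" "\<forall>j\<in>J. (\<Sum>x\<in>A. c0 x * f j x) = 0"
      using underdetermined_system_nontrivial_solution[OF assms(1) less.prems(1), of f] by auto
    obtain c where c: "\<exists>x\<in>A. 0 < c x" "\<forall>j\<in>J. (\<Sum>x\<in>A. c x * f j x) = 0"
    proof (cases "\<exists>x\<in>A. 0 < c0 x")
      case True
      with c0 that show ?thesis
        by blast
    next
      case False
      with c0(1) have "\<exists>x\<in>A. 0 < - c0 x"
        by (metis linorder_cases neg_0_less_iff_less)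
      with c0(2) that[of "\<lambda>x. - c0 x"] show ?thesis
        by (simp add: sum_negf)
    qed
    define T where "T = (\<lambda>x. w x / c x) ` {x\<in>A. 0 < c x}"
    have T: "finite T" "T \<noteq> {}"
      using less.prems(1) c(1) by (auto simp: T_def)
    define t where "t = Min T"
    have "t \<in> T"
      unfolding t_def using T by (rule Min_in)
    then obtain p where p: "p \<in> A" "0 < c p" "t = w p / c p"
      by (auto simp: T_def)
    have t_pos: "0 < t"
      using p less.prems(2) by simp
    define w' where "w' x = w x - t * c x" for x
    have w'_nonneg: "0 \<le> w' x" if "x \<in> A" for x
    proof (cases "0 < c x")
      case True
      then have "t \<le> w x / c x"
        unfolding t_def using T(1) that by (intro Min_le) (auto simp: T_def)
      with True show ?thesis
        by (simp add: w'_def field_simps)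
    next
      case False
      then have "t * c x \<le> 0"
        using t_pos by (simp add: mult_le_0_iff)
      moreover have "0 < w x"
        using less.prems(2) that by blast
      ultimately show ?thesis
        by (simp add: w'_def)
    qed
    define A' where "A' = {x\<in>A. 0 < w' x}"
    have "p \<notin> A'"
      using p by (simp add: A'_def w'_def)
    then have "card A' < card A"
      using p(1) less.prems(1) by (intro psubset_card_mono) (auto simp: A'_def)
    moreover have "finite A'" "\<forall>x\<in>A'. 0 < w' x"
      using less.prems(1) by (auto simp: A'_def)
    ultimately obtain B v where B: "B \<subseteq> A'" "card B \<le> card J" "\<forall>x\<in>B. 0 < v x"
        "\<forall>j\<in>J. (\<Sum>x\<in>B. v x * f j x) = (\<Sum>x\<in>A'. w' x * f j x)"
      using less.hyps[of A' w'] by blast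
    have "(\<Sum>x\<in>A'. w' x * f j x) = (\<Sum>x\<in>A. w x * f j x)" if "j \<in> J" for j
    proof -
      have "w' x = 0" if "x \<in> A - A'" for x
        using w'_nonneg[of x] that by (auto simp: A'_def)
      then have "(\<Sum>x\<in>A'. w' x * f j x) = (\<Sum>x\<in>A. w' x * f j x)"
        using less.prems(1) by (intro sum.mono_neutral_left) (auto simp: A'_def)
      also have "\<dots> = (\<Sum>x\<in>A. w x * f j x) - t * (\<Sum>x\<in>A. c x * f j x)"
        by (simp add: w'_def left_diff_distrib sum_subtractf sum_distrib_left mult.assoc)
      finally show ?thesis
        using c(2) that by simp
    qed
    with B show ?thesis
      by (intro exI[of _ B] exI[of _ v]) (auto simp: A'_def)
  qed
qed


section \<open>Monomials\<close>

text \<open>Stars and bars: with the slack \<open>D - (\<Sum>k. \<alpha> k)\<close> as a further entry, an exponent becomes a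
  list of \<open>d + 1\<close> natural numbers with sum exactly \<open>D\<close>.\<close>

lemma card_exponents_le:
  "card (exponents_le D :: ('n::finite \<Rightarrow> nat) set) \<le> (D + CARD('n)) choose CARD('n)"
proof -
  obtain ks :: "'n list" where ks: "set ks = UNIV" "distinct ks"
    using finite_distinct_list[of "UNIV :: 'n set"] by auto
  have len: "length ks = CARD('n)"
    using ks by (metis distinct_card)
  define L where "L = {l :: nat list. length l = Suc CARD('n) \<and> sum_list l = D}"
  define F where "F \<alpha> = (D - (\<Sum>k\<in>UNIV. \<alpha> k)) # map \<alpha> ks" for \<alpha> :: "'n \<Rightarrow> nat"
  have "inj_on F (exponents_le D)"
    using ks(1) by (intro inj_onI) (auto simp: F_def fun_eq_iff)
  moreover have "F ` exponents_le D \<subseteq> L"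
  proof
    fix l assume "l \<in> F ` exponents_le D"
    then obtain \<alpha> :: "'n \<Rightarrow> nat" where \<alpha>: "(\<Sum>k\<in>UNIV. \<alpha> k) \<le> D" "l = F \<alpha>"
      by (auto simp: exponents_le_def)
    have "sum_list (map \<alpha> ks) = (\<Sum>k\<in>UNIV. \<alpha> k)"
      using sum_list_distinct_conv_sum_set[OF ks(2), of \<alpha>] ks(1) by simp
    with \<alpha> len show "l \<in> L"
      by (simp add: F_def L_def)
  qed
  moreover have card_L: "card L = (D + CARD('n)) choose D"
    using card_length_sum_list[of "Suc CARD('n)" D] by (simp add: L_def)
  moreover have "finite L"
    using card_L by (intro card_ge_0_finite) simp
  ultimately have "card (exponents_le D :: ('n \<Rightarrow> nat) set) \<le> (D + CARD('n)) choose D"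
    using card_inj_on_le by metis
  then show ?thesis
    using binomial_symmetric[of D "D + CARD('n)"] by simp
qed

lemma polys_le_mono:
  assumes "D \<le> E"
  shows "polys_le D \<subseteq> (polys_le E :: (real ^ 'n::finite \<Rightarrow> real) set)"
proof
  fix p :: "real ^ 'n \<Rightarrow> real"
  assume "p \<in> polys_le D"
  then obtain c where p: "p = (\<lambda>x. \<Sum>\<alpha>\<in>exponents_le D. c \<alpha> * monomial_fun \<alpha> x)"
    by (auto simp: polys_le_def)
  define c' where "c' \<alpha> = (if \<alpha> \<in> exponents_le D then c \<alpha> else 0)" for \<alpha>
  have "exponents_le D \<subseteq> exponents_le E"
    using assms by (auto simp: exponents_le_def)
  then have "(\<Sum>\<alpha>\<in>exponents_le D. c \<alpha> * monomial_fun \<alpha> x)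
      = (\<Sum>\<alpha>\<in>exponents_le E. c' \<alpha> * monomial_fun \<alpha> x)" for x
    by (intro sum.mono_neutral_cong_left) (auto simp: c'_def finite_exponents_le)
  with p show "p \<in> polys_le E"
    by (auto simp: polys_le_def)
qed

lemma const_one_in_polys_le: "(\<lambda>_. 1) \<in> polys_le D"
proof -
  define c where "c \<alpha> = (if \<alpha> = (\<lambda>_. 0) then 1 else 0 :: real)" for \<alpha> :: "'a \<Rightarrow> nat"
  have "(\<Sum>\<alpha>\<in>exponents_le 0. c \<alpha> * monomial_fun \<alpha> x) = 1" for x
  proof -
    have "exponents_le 0 = {\<lambda>_::'a. 0::nat}"
      by (auto simp: exponents_le_def fun_eq_iff)
    then show ?thesis
      by (simp add: c_def monomial_fun_def)
  qed
  then have "(\<lambda>_. 1) \<in> (polys_le 0 :: (real ^ 'a \<Rightarrow> real) set)"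
    unfolding polys_le_def by (intro CollectI exI[of _ c]) simp
  then show ?thesis
    using polys_le_mono[of 0 D] by auto
qed

lemma monomial_sums_determine_poly_sum:
  assumes "p \<in> polys_le D"
    and "\<And>\<alpha>. \<alpha> \<in> exponents_le D \<Longrightarrow>
      (\<Sum>x\<in>Y. monomial_fun \<alpha> x * v x) = (\<Sum>x\<in>X. monomial_fun \<alpha> x * w x)"
  shows "(\<Sum>x\<in>Y. p x * v x) = (\<Sum>x\<in>X. p x * w x)"
proof -
  obtain c where p: "p = (\<lambda>x. \<Sum>\<alpha>\<in>exponents_le D. c \<alpha> * monomial_fun \<alpha> x)"
    using assms(1) by (auto simp: polys_le_def)
  have *: "(\<Sum>x\<in>Z. p x * u x) = (\<Sum>\<alpha>\<in>exponents_le D. c \<alpha> * (\<Sum>x\<in>Z. monomial_fun \<alpha> x * u x))"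
    for Z u
    unfolding p sum_distrib_left sum_distrib_right
    by (subst sum.swap) (simp add: mult.assoc)
  show ?thesis
    unfolding * using assms(2) by (intro sum.cong) auto
qed


section \<open>Reflections and absolute values\<close>

definition abs_vec :: "real ^ 'n::finite \<Rightarrow> real ^ 'n" where
  "abs_vec x = (\<chi> k. \<bar>x $ k\<bar>)"

lemma abs_vec_reflect_coord [simp]: "abs_vec (reflect_coord k x) = abs_vec x"
  by (simp add: abs_vec_def reflect_coord_def vec_eq_iff)

lemma reflect_coord_involutive [simp]: "reflect_coord k (reflect_coord k x) = x"
  by (simp add: reflect_coord_def vec_eq_iff)

lemma monomial_fun_abs_vec:
  assumes "\<And>k. even (\<alpha> k)"
  shows "monomial_fun \<alpha> (abs_vec x) = monomial_fun \<alpha> x"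
  using assms by (simp add: monomial_fun_def abs_vec_def power_even_abs)

lemma monomial_fun_reflect_coord_odd:
  assumes "odd (\<alpha> k)"
  shows "monomial_fun \<alpha> (reflect_coord k x) = - monomial_fun \<alpha> x"
proof -
  have split: "monomial_fun \<alpha> y = (y $ k) ^ \<alpha> k * (\<Prod>j\<in>UNIV - {k}. (y $ j) ^ \<alpha> j)" for y
    unfolding monomial_fun_def by (rule prod.remove) auto
  have "(\<Prod>j\<in>UNIV - {k}. (reflect_coord k x $ j) ^ \<alpha> j) = (\<Prod>j\<in>UNIV - {k}. (x $ j) ^ \<alpha> j)"
    by (rule prod.cong) (auto simp: reflect_coord_def)
  moreover have "(reflect_coord k x $ k) ^ \<alpha> k = - ((x $ k) ^ \<alpha> k)"
    using assms by (simp add: reflect_coord_def)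
  ultimately show ?thesis
    by (simp add: split)
qed

lemma symmetric_rule_sums_odd_monomial_to_zero:
  assumes "type1_symmetric X w" "odd (\<alpha> k)"
  shows "(\<Sum>x\<in>X. monomial_fun \<alpha> x * w x) = 0"
proof -
  have "(\<Sum>x\<in>X. monomial_fun \<alpha> x * w x) = (\<Sum>x\<in>X. - (monomial_fun \<alpha> x * w x))"
    using assms
    by (intro sum.reindex_bij_witness[of _ "reflect_coord k" "reflect_coord k"])
      (auto simp: type1_symmetric_def monomial_fun_reflect_coord_odd)
  then show ?thesis
    by (simp add: sum_negf)
qed

text \<open>A vector with given absolute values is determined by the set of its positive entries.\<close>

lemma
  fixes a :: "real ^ 'n::finite"
  shows finite_abs_vec_fibre: "finite {x. abs_vec x = a}"
    and card_abs_vec_fibre: "card {x. abs_vec x = a} \<le> 2 ^ CARD('n)"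
proof -
  have inj: "inj_on (\<lambda>x. {k. 0 < x $ k}) {x. abs_vec x = a}"
  proof (rule inj_onI)
    fix x y :: "real ^ 'n"
    assume "x \<in> {x. abs_vec x = a}" "y \<in> {x. abs_vec x = a}"
      and signs: "{k. 0 < x $ k} = {k. 0 < y $ k}"
    then have "\<bar>x $ k\<bar> = \<bar>y $ k\<bar>" for k
      by (auto simp: abs_vec_def vec_eq_iff)
    moreover have "0 < x $ k \<longleftrightarrow> 0 < y $ k" for k
      using signs by blast
    ultimately have "x $ k = y $ k" for k
      by (smt (verit))
    then show "x = y"
      by (simp add: vec_eq_iff)
  qed
  show "finite {x. abs_vec x = a}"
    using inj by (rule inj_on_finite[of _ _ UNIV]) auto
  have "card {x. abs_vec x = a} \<le> card (UNIV :: 'n set set)"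
    using inj by (rule card_inj_on_le) auto
  then show "card {x. abs_vec x = a} \<le> 2 ^ CARD('n)"
    by (simp add: card_UNIV_set)
qed


section \<open>Reduction of a symmetric rule\<close>

text \<open>The points \<open>a\<close> below are the merged nodes, \<open>fibre a\<close> is the set of nodes merged into \<open>a\<close>,
  and its size is the denominator that turns the weight of a point back into equal weights of its
  nodes.\<close>

lemma symmetric_rule_reduction:
  fixes X :: "(real ^ 'n::finite) set" and w :: "real ^ 'n \<Rightarrow> real"
  assumes "finite X" and sym: "type1_symmetric X w" and pos: "positive_weights X w"
  shows "\<exists>Y v. Y \<subseteq> X \<and> card Y \<le> 2 ^ CARD('n) * ((D div 2 + CARD('n)) choose CARD('n)) \<and>
    type1_symmetric Y v \<and> positive_weights Y v \<and>
    (\<forall>p\<in>polys_le D. (\<Sum>x\<in>Y. p x * v x) = (\<Sum>x\<in>X. p x * w x))"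
proof -
  define fibre where "fibre a = {x\<in>X. abs_vec x = a}" for a
  define J where "J = (exponents_le (D div 2) :: ('n \<Rightarrow> nat) set)"
  define f where "f \<beta> = monomial_fun (\<lambda>k. 2 * \<beta> k)" for \<beta> :: "'n \<Rightarrow> nat"
  define W where "W a = (\<Sum>x\<in>fibre a. w x)" for a
  have fin: "finite (fibre a)" for a
    using assms(1) by (simp add: fibre_def)
  have fibre_pos: "0 < card (fibre a)" if "a \<in> abs_vec ` X" for a
    using that fin[of a] by (auto simp: card_gt_0_iff fibre_def)
  have "\<forall>a\<in>abs_vec ` X. 0 < W a"
    using pos fibre_pos unfolding W_def
    by (intro ballI sum_pos) (auto simp: positive_weights_def fibre_def card_gt_0_iff)
  then obtain B V where B: "B \<subseteq> abs_vec ` X" "card B \<le> card J" "\<forall>a\<in>B. 0 < V a"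
      "\<forall>\<beta>\<in>J. (\<Sum>a\<in>B. V a * f \<beta> a) = (\<Sum>a\<in>abs_vec ` X. W a * f \<beta> a)"
    using caratheodory_positive_weights[of J "abs_vec ` X" W f] assms(1)
    by (auto simp: J_def finite_exponents_le)
  have fin_B: "finite B"
    using B(1) assms(1) finite_subset by blast
  define Y where "Y = {x\<in>X. abs_vec x \<in> B}"
  define v where "v x = V (abs_vec x) / card (fibre (abs_vec x))" for x
  have Y_sub: "Y \<subseteq> X"
    by (auto simp: Y_def)
  have sym_Y: "type1_symmetric Y v"
    using sym by (auto simp: type1_symmetric_def Y_def v_def)
  have pos_Y: "positive_weights Y v"
    using B(1,3) fibre_pos by (auto simp: positive_weights_def Y_def v_def)

  have "card Y \<le> 2 ^ CARD('n) * ((D div 2 + CARD('n)) choose CARD('n))"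
  proof -
    have "Y = (\<Union>a\<in>B. fibre a)"
      by (auto simp: Y_def fibre_def)
    then have "card Y \<le> (\<Sum>a\<in>B. card (fibre a))"
      using card_UN_le[OF fin_B] by simp
    also have "\<dots> \<le> (\<Sum>a\<in>B. 2 ^ CARD('n))"
    proof (rule sum_mono)
      fix a
      have "card (fibre a) \<le> card {x. abs_vec x = a}"
        by (rule card_mono[OF finite_abs_vec_fibre]) (auto simp: fibre_def)
      then show "card (fibre a) \<le> 2 ^ CARD('n)"
        using card_abs_vec_fibre[of a] by linarith
    qed
    also have "\<dots> \<le> 2 ^ CARD('n) * card J"
      using B(2) by simp
    finally show ?thesis
      using card_exponents_le[of "D div 2", where 'n = 'n] unfolding J_def
      by (meson le_trans mult_le_mono2)
  qed
  moreover have "(\<Sum>x\<in>Y. monomial_fun \<alpha> x * v x) = (\<Sum>x\<in>X. monomial_fun \<alpha> x * w x)"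
    if \<alpha>: "\<alpha> \<in> exponents_le D" for \<alpha>
  proof (cases "\<forall>k. even (\<alpha> k)")
    case True
    define \<beta> where "\<beta> k = \<alpha> k div 2" for k
    have \<alpha>_eq: "\<alpha> = (\<lambda>k. 2 * \<beta> k)"
      using True by (auto simp: \<beta>_def)
    have "2 * (\<Sum>k\<in>UNIV. \<beta> k) \<le> D"
      using \<alpha> by (simp add: exponents_le_def \<alpha>_eq sum_distrib_left)
    then have \<beta>: "\<beta> \<in> J"
      by (simp add: J_def exponents_le_def)
    have on_fibre: "monomial_fun \<alpha> x = f \<beta> a" if "x \<in> fibre a" for x a
      using that monomial_fun_abs_vec[of \<alpha> x] True by (auto simp: fibre_def f_def \<alpha>_eq)
    have "(\<Sum>x\<in>Y. monomial_fun \<alpha> x * v x)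
        = (\<Sum>a\<in>B. \<Sum>x\<in>{x\<in>Y. abs_vec x = a}. monomial_fun \<alpha> x * v x)"
      using fin_B assms(1) Y_sub by (intro sum.group[symmetric]) (auto simp: Y_def)
    also have "\<dots> = (\<Sum>a\<in>B. \<Sum>x\<in>fibre a. f \<beta> a * (V a / card (fibre a)))"
    proof (rule sum.cong[OF refl], rule sum.cong)
      fix a assume "a \<in> B"
      then show "{x\<in>Y. abs_vec x = a} = fibre a"
        by (auto simp: Y_def fibre_def)
    next
      fix a x assume "x \<in> fibre a"
      then show "monomial_fun \<alpha> x * v x = f \<beta> a * (V a / card (fibre a))"
        using on_fibre[of x a] by (auto simp: v_def fibre_def)
    qed
    also have "\<dots> = (\<Sum>a\<in>B. V a * f \<beta> a)"
    proof (rule sum.cong[OF refl])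
      fix a assume "a \<in> B"
      then have "0 < card (fibre a)"
        using B(1) fibre_pos by blast
      then show "(\<Sum>x\<in>fibre a. f \<beta> a * (V a / card (fibre a))) = V a * f \<beta> a"
        by simp
    qed
    also have "\<dots> = (\<Sum>a\<in>abs_vec ` X. W a * f \<beta> a)"
      using B(4) \<beta> by blast
    also have "\<dots> = (\<Sum>a\<in>abs_vec ` X. \<Sum>x\<in>fibre a. monomial_fun \<alpha> x * w x)"
      by (simp add: W_def sum_distrib_left on_fibre mult.commute[of _ "f \<beta> _"])
    also have "\<dots> = (\<Sum>x\<in>X. monomial_fun \<alpha> x * w x)"
      unfolding fibre_def using assms(1) by (intro sum.group) auto
    finally show ?thesis .
  next
    case False
    then obtain k where "odd (\<alpha> k)"
      by blast
    then show ?thesis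
      using symmetric_rule_sums_odd_monomial_to_zero[OF sym]
        symmetric_rule_sums_odd_monomial_to_zero[OF sym_Y] by simp
  qed
  then have "\<forall>p\<in>polys_le D. (\<Sum>x\<in>Y. p x * v x) = (\<Sum>x\<in>X. p x * w x)"
    using monomial_sums_determine_poly_sum[where D = D and Y = Y and X = X] by blast
  ultimately show ?thesis
    using Y_sub sym_Y pos_Y by blast
qed

text \<open>A rule on the empty set would integrate the constant \<open>1\<close> to \<open>0\<close>.\<close>

lemma exact_rule_nonempty:
  assumes "prob_space P" "cubature_degree_ge P Y v D"
  shows "Y \<noteq> {}"
proof
  assume "Y = {}"
  then have "(\<integral>x. 1 \<partial>P) = (0 :: real)"
    using assms(2) const_one_in_polys_le
    by (fastforce simp: cubature_degree_ge_def integrates_exactly_def)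
  then show False
    using prob_space.prob_space[OF assms(1)] by simp
qed

theorem theorem3:
  fixes P :: "(real ^ 'n::finite) measure"
    and \<Xi> :: "(real ^ 'n) set"
    and \<xi> :: "nat \<Rightarrow> real ^ 'n"
    and w :: "real ^ 'n \<Rightarrow> real"
    and N K I :: nat
  assumes "prob_space P"
    and "sets P = sets (restrict_space borel \<Xi>)"
    and "1 \<le> K"
    and "type1_symmetric (\<xi> ` {1..N}) w"
    and "positive_weights (\<xi> ` {1..N}) w"
    and "cubature_degree P (\<xi> ` {1..N}) w K"
    and "\<forall>k\<in>{1..N}. \<not> shared_between_orthants (\<xi> k)"
    and "I = 2 ^ CARD('n) * (((K - 1) div 2 + CARD('n)) choose CARD('n))"
  shows "\<exists>i :: nat \<Rightarrow> nat. i ` {1..I} \<subseteq> {1..N} \<and>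
    (\<exists>v. type1_symmetric ((\<lambda>j. \<xi> (i j)) ` {1..I}) v \<and>
         positive_weights ((\<lambda>j. \<xi> (i j)) ` {1..I}) v \<and>
         cubature_degree_ge P ((\<lambda>j. \<xi> (i j)) ` {1..I}) v (K - 1))"
proof -
  obtain Y v where Y: "Y \<subseteq> \<xi> ` {1..N}" "card Y \<le> I" "type1_symmetric Y v" "positive_weights Y v"
      "\<forall>p\<in>polys_le (K - 1). (\<Sum>x\<in>Y. p x * v x) = (\<Sum>x\<in>\<xi> ` {1..N}. p x * w x)"
    using symmetric_rule_reduction[OF _ assms(4,5), of "K - 1"] assms(8) by auto
  have exact: "cubature_degree_ge P Y v (K - 1)"
    unfolding cubature_degree_ge_def
  proof
    fix p :: "real ^ 'n \<Rightarrow> real"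
    assume p: "p \<in> polys_le (K - 1)"
    then have "p \<in> polys_le K"
      using polys_le_mono[of "K - 1" K] by auto
    then have "integrates_exactly P (\<xi> ` {1..N}) w p"
      using assms(6) by (simp add: cubature_degree_def cubature_degree_ge_def)
    with p Y(5) show "integrates_exactly P Y v p"
      by (simp add: integrates_exactly_def)
  qed
  \<comment> \<open>\<open>Y\<close> may have fewer than \<open>I\<close> elements. The indices then repeat some nodes, for which \<open>Y\<close> must
    have at least one.\<close>
  have "Y \<noteq> {}"
    using exact_rule_nonempty[OF assms(1) exact] .
  moreover have "finite Y"
    using Y(1) finite_surj by blast
  then have "\<exists>g. inj_on g Y \<and> g ` Y \<subseteq> {1..I}"
    using Y(2) card_le_inj[of Y "{1..I}"] by auto
  ultimately obtain h where h: "h ` {1..I} = Y"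
    using inj_on_iff_surj[of Y "{1..I}"] by metis
  define i where "i j = (SOME m. m \<in> {1..N} \<and> \<xi> m = h j)" for j
  have i: "i j \<in> {1..N} \<and> \<xi> (i j) = h j" if "j \<in> {1..I}" for j
  proof -
    have "h j \<in> \<xi> ` {1..N}"
      using h Y(1) that by blast
    then have "\<exists>m. m \<in> {1..N} \<and> \<xi> m = h j"
      by (auto simp: image_iff)
    then show ?thesis
      unfolding i_def by (rule someI_ex)
  qed
  then have "(\<lambda>j. \<xi> (i j)) ` {1..I} = Y"
    using h by (metis (no_types, lifting) image_cong)
  moreover have "i ` {1..I} \<subseteq> {1..N}"
    using i by blast
  ultimately show ?thesis
    using Y(3,4) exact by auto
qed

end
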